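(* Let $1\le b\le m$ be integers and let $(x_0,x_1,\dots,x_b)$ be an arbitrary probability distribution on $\{0,1,\dots,b\}$. For $0\le i\le b$ put $z_i=x_0+\cdots+x_i$ and $\bar z_i=1-z_i=x_{i+1}+\cdots+x_b$. Let $w\in\mathbb{B}^{m,b}$, let $k$ be the number of $1$'s in $w$, and let $n_1<\dots<n_k$ be the positions of the $1$'s in $w$. Then the (unique) stationary distribution $\pi$ of the Reverse Juggling Markov Chain (RJMC) on $\mathbb{B}^{m,b}$ is given by $$\pi(w)=\prod_{i=0}^{k-1}\bar z_i\ \prod_{i=0}^{k} z_i^{\,n_{i+1}-n_i-1},$$ where $n_0=0$ and $n_{k+1}=m+1$.
   Context: $\mathbb{B}^{m,b}$ is the set of binary words $w=(w_1,\dots,w_m)$ of length $m$ with at most $b$ ones. The Reverse Juggling Markov Chain (RJMC) on $\mathbb{B}^{m,b}$ has the following transitions from $w$, where $\ell$ denotes the number of ones among the first $m-1$ letters $w_1,\dots,w_{m-1}$: (1) with probability $x_0$, go to $(0,w_1,\dots,w_{m-1})$; (2) for each $1\le i\le \ell$, with probability $x_i$, go to $(1,w'_1,\dots,w'_{m-1})$, where $(w'_1,\dots,w'_{m-1})$ is obtained from $(w_1,\dots,w_{m-1})$ by replacing its $i$'th one from the left by a zero; (3) with probability $x_{\ell+1}+\cdots+x_b$, go to $(1,w_1,\dots,w_{m-1})$ (this probability is $0$ if $\ell=b$). A stationary distribution is a probability (row) vector $\pi$ with $\pi M=\pi$, where $M$ is the transition matrix. Convention: $0^0=1$. *)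

theory Defs
  imports Complex_Main
begin

(* Binary words are boolean lists, the letter 1 being True; the j-th letter
   (j = 1, ..., m) of w is w ! (j - 1). *)

abbreviation num_ones :: "bool list \<Rightarrow> nat" where
  "num_ones w \<equiv> count_list w True"

definition words :: "nat \<Rightarrow> nat \<Rightarrow> bool list set" where
  "words m b = {w. length w = m \<and> num_ones w \<le> b}"

(* The 1-based position n_i of the i-th one of w, with the conventions
   n_0 = 0 and n_{k+1} = m + 1, where k = num_ones w and m = length w;
   only meaningful for i \<le> k + 1. *)
definition one_pos :: "bool list \<Rightarrow> nat \<Rightarrow> nat" where
  "one_pos w i = (0 # filter (\<lambda>j. w ! (j - 1)) [1..<length w + 1] @ [length w + 1]) ! i"

(* Replaces the i-th one from the left by a zero, for 1 \<le> i \<le> num_ones w. *)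
definition erase_one :: "nat \<Rightarrow> bool list \<Rightarrow> bool list" where
  "erase_one i w = w[one_pos w i - 1 := False]"

(* Entry (w, v) of the transition matrix of the RJMC: the total probability of the
   moves that lead from w to v. Here u = (w_1, ..., w_{m-1}). *)
definition rjmc :: "nat \<Rightarrow> (nat \<Rightarrow> real) \<Rightarrow> bool list \<Rightarrow> bool list \<Rightarrow> real" where
  "rjmc b x w v =
     (let u = butlast w; l = num_ones u in
        (if v = False # u then x 0 else 0)
      + (\<Sum>i = 1..l. if v = True # erase_one i u then x i else 0)
      + (if v = True # u then (\<Sum>i = l + 1..b. x i) else 0))"

(* The values of p outside the (finite) state space S are irrelevant. *)
definition stationary_distribution ::
    "'s set \<Rightarrow> ('s \<Rightarrow> 's \<Rightarrow> real) \<Rightarrow> ('s \<Rightarrow> real) \<Rightarrow> bool" where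
  "stationary_distribution S M p \<longleftrightarrow>
     (\<forall>s\<in>S. p s \<ge> 0) \<and> (\<Sum>s\<in>S. p s) = 1 \<and>
     (\<forall>t\<in>S. (\<Sum>s\<in>S. p s * M s t) = p t)"

definition z :: "(nat \<Rightarrow> real) \<Rightarrow> nat \<Rightarrow> real" where
  "z x i = (\<Sum>j\<le>i. x j)"

definition zbar :: "(nat \<Rightarrow> real) \<Rightarrow> nat \<Rightarrow> real" where
  "zbar x i = 1 - z x i"

end

(* Both parts rest on reading words from right to left. Appending a letter c to a word with
   k ones multiplies the claimed weight by zbar_k if c = 1 and by z_k if c = 0, and a move of
   the chain is prepending a letter according to an index i drawn from x; the first n + 1
   letters of the new word depend only on i and the first n letters of the old one. Induction
   on the length through the last letter then shows that the weight is invariant, and that the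
   expectation of any function of the first n letters is the same for all stationary
   distributions, hence uniqueness. *)

theory Submission
  imports Defs
begin

section \<open>Positions of the ones\<close>

lemma positions_snoc:
  "filter (\<lambda>j. (w @ [c]) ! (j - 1)) [1..<length (w @ [c]) + 1] =
   filter (\<lambda>j. w ! (j - 1)) [1..<length w + 1] @ (if c then [length w + 1] else [])"
proof -
  have "filter (\<lambda>j. (w @ [c]) ! (j - 1)) [1..<length w + 1] =
        filter (\<lambda>j. w ! (j - 1)) [1..<length w + 1]"
    by (rule filter_cong) (auto simp: nth_append)
  then show ?thesis by (simp add: nth_append)
qed

lemma length_positions:
  "length (filter (\<lambda>j. w ! (j - 1)) [1..<length w + 1]) = num_ones w"
proof (induction w rule: rev_induct)
  case (snoc c w)
  then show ?case unfolding positions_snoc by simp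
qed simp

lemma one_pos_snoc:
  assumes "i \<le> num_ones w"
  shows "one_pos (w @ [c]) i = one_pos w i"
proof -
  let ?P = "\<lambda>w. filter (\<lambda>j. w ! (j - 1)) [1..<length w + 1]"
  have len: "length (0 # ?P w) = Suc (num_ones w)"
    using length_positions[of w] by simp
  have "one_pos (w @ [c]) i = ((0 # ?P w) @ (if c then [length w + 1] else []) @ [length w + 2]) ! i"
    unfolding one_pos_def positions_snoc by simp
  \<comment> \<open>The bound on \<open>i\<close> keeps the index inside the common prefix
    \<open>0 # ?P w\<close>, before any new position and the sentinel.\<close>
  also have "\<dots> = (0 # ?P w) ! i"
    using len assms by (subst nth_append) auto
  also have "\<dots> = ((0 # ?P w) @ [length w + 1]) ! i"
    using len assms by (subst nth_append) auto
  finally show ?thesis by (simp add: one_pos_def)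
qed

lemma one_pos_last: "one_pos w (Suc (num_ones w)) = length w + 1"
  using length_positions[of w] by (simp add: one_pos_def nth_append)

lemma one_pos_snoc_True: "one_pos (w @ [True]) (Suc (num_ones w)) = length w + 1"
  using length_positions[of w]
  unfolding one_pos_def positions_snoc by (simp add: nth_append)

lemma one_pos_le_length:
  assumes "i \<le> num_ones w"
  shows "one_pos w i \<le> length w"
  using assms
proof (induction w rule: rev_induct)
  case Nil
  then show ?case by (simp add: one_pos_def)
next
  case (snoc c w)
  show ?case
  proof (cases "i \<le> num_ones w")
    case True
    then show ?thesis using snoc.IH by (simp add: one_pos_snoc)
  next
    case False
    then have "c" "i = Suc (num_ones w)" using snoc.prems by (auto split: if_splits)
    then show ?thesis by (simp add: one_pos_snoc_True)
  qed
qed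

lemma one_pos_pos:
  assumes "1 \<le> i" "i \<le> num_ones w"
  shows "1 \<le> one_pos w i"
  using assms
proof (induction w rule: rev_induct)
  case (snoc c w)
  show ?case
  proof (cases "i \<le> num_ones w")
    case True
    then show ?thesis using snoc by (simp add: one_pos_snoc)
  next
    case False
    then have "c" "i = Suc (num_ones w)" using snoc.prems by (auto split: if_splits)
    then show ?thesis by (simp add: one_pos_snoc_True)
  qed
qed simp

lemma erase_one_snoc:
  assumes "1 \<le> i" "i \<le> num_ones w"
  shows "erase_one i (w @ [c]) = erase_one i w @ [c]"
proof -
  have "one_pos w i - 1 < length w"
    using one_pos_le_length[OF assms(2)] one_pos_pos[OF assms] by linarith
  then show ?thesis
    using assms by (simp add: erase_one_def one_pos_snoc list_update_append)
qed

lemma erase_one_snoc_True: "erase_one (Suc (num_ones w)) (w @ [True]) = w @ [False]"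
  by (simp add: erase_one_def one_pos_snoc_True)


section \<open>The chain as a random map\<close>

text \<open>\<open>u\<close> is the state with its last letter already dropped. All indices above
  \<open>num_ones u\<close> give the same word, so together they carry the probability of transition
  (3).\<close>

definition move :: "nat \<Rightarrow> bool list \<Rightarrow> bool list" where
  "move i u = (i \<noteq> 0) # (if 1 \<le> i \<and> i \<le> num_ones u then erase_one i u else u)"

lemma move_Nil [simp]: "move i [] = [i \<noteq> 0]"
  by (auto simp: move_def)

text \<open>The last letter changes only if it is itself the one to be erased; if it is a zero and
  \<open>i = Suc (num_ones r)\<close>, nothing is erased and it stays zero.\<close>

lemma move_snoc: "move i (r @ [c]) = move i r @ [c \<and> i \<noteq> Suc (num_ones r)]"
proof -
  consider "i = 0" | "1 \<le> i" "i \<le> num_ones r" | "i = Suc (num_ones r)" | "i > Suc (num_ones r)"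
    by linarith
  then show ?thesis
    by cases (auto simp: move_def erase_one_snoc erase_one_snoc_True)
qed

lemma length_move [simp]: "length (move i u) = Suc (length u)"
  by (simp add: move_def erase_one_def)

lemma num_ones_move: "num_ones (move i u) = (if i \<le> num_ones u then num_ones u else Suc (num_ones u))"
  by (induction u rule: rev_induct) (auto simp: move_snoc)

lemma take_move:
  assumes "n \<le> length u"
  shows "take (Suc n) (move i u) = move i (take n u)"
  using assms
proof (induction u rule: rev_induct)
  case (snoc c u)
  then show ?case by (cases "n = Suc (length u)") (auto simp: move_snoc)
qed simp

lemma num_ones_butlast: "num_ones (butlast w) \<le> num_ones w"
  by (cases w rule: rev_cases) auto

lemma rjmc_eq_move:
  assumes "num_ones w \<le> b"
  shows "rjmc b x w v = (\<Sum>i\<le>b. if v = move i (butlast w) then x i else 0)"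
proof -
  define u where "u = butlast w"
  define l where "l = num_ones u"
  have l: "l \<le> b" using assms num_ones_butlast[of w] by (simp add: l_def u_def)
  define f where "f i = (if v = move i u then x i else 0)" for i
  have "{..b} = insert 0 ({1..l} \<union> {l+1..b})" using l by auto
  then have "sum f {..b} = f 0 + (sum f {1..l} + sum f {l+1..b})"
    by (simp add: sum.union_disjoint)
  also have "f 0 = (if v = False # u then x 0 else 0)"
    by (simp add: f_def move_def)
  also have "sum f {1..l} = (\<Sum>i = 1..l. if v = True # erase_one i u then x i else 0)"
    by (rule sum.cong) (auto simp: f_def move_def l_def)
  also have "sum f {l+1..b} = (\<Sum>i = l+1..b. if v = True # u then x i else 0)"
    by (rule sum.cong) (auto simp: f_def move_def l_def)
  finally show ?thesis
    by (simp add: rjmc_def Let_def f_def flip: u_def l_def)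
qed


section \<open>Uniqueness\<close>

lemma finite_lists_length: "finite {w :: bool list. length w = n}"
  using finite_lists_length_eq[of "UNIV :: bool set" n] by simp

lemma finite_words [simp]: "finite (words m b)"
  by (rule finite_subset[OF _ finite_lists_length[of m]]) (auto simp: words_def)

lemma move_butlast_in_words:
  assumes "w \<in> words m b" "1 \<le> m" "i \<le> b"
  shows "move i (butlast w) \<in> words m b"
  using assms num_ones_butlast[of w] by (auto simp: words_def num_ones_move)

text \<open>Stationarity tested against \<open>h\<close>: the mean of \<open>h\<close> is unchanged
  by one step of the chain.\<close>

lemma stationary_expectation:
  assumes "stationary_distribution (words m b) (rjmc b x) p" "1 \<le> m"
  shows "(\<Sum>w\<in>words m b. p w * h w) =
         (\<Sum>w\<in>words m b. p w * (\<Sum>i\<le>b. x i * h (move i (butlast w))))"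
proof -
  let ?W = "words m b"
  have "(\<Sum>t\<in>?W. p t * h t) = (\<Sum>t\<in>?W. (\<Sum>w\<in>?W. p w * rjmc b x w t) * h t)"
    using assms by (intro sum.cong) (auto simp: stationary_distribution_def)
  also have "\<dots> = (\<Sum>w\<in>?W. \<Sum>t\<in>?W. p w * (rjmc b x w t * h t))"
    by (subst sum.swap) (simp add: sum_distrib_right mult.assoc)
  also have "\<dots> = (\<Sum>w\<in>?W. p w * (\<Sum>i\<le>b. x i * h (move i (butlast w))))"
  proof (rule sum.cong)
    fix w assume w: "w \<in> ?W"
    have "(\<Sum>t\<in>?W. rjmc b x w t * h t) =
          (\<Sum>t\<in>?W. \<Sum>i\<le>b. if t = move i (butlast w) then x i * h t else 0)"
      using w by (intro sum.cong)
        (auto simp: rjmc_eq_move words_def sum_distrib_right intro!: sum.cong)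
    also have "\<dots> = (\<Sum>i\<le>b. \<Sum>t\<in>?W. if t = move i (butlast w) then x i * h t else 0)"
      by (rule sum.swap)
    also have "\<dots> = (\<Sum>i\<le>b. x i * h (move i (butlast w)))"
      using w assms by (intro sum.cong) (auto simp: move_butlast_in_words)
    finally show "(\<Sum>t\<in>?W. p w * (rjmc b x w t * h t)) =
        p w * (\<Sum>i\<le>b. x i * h (move i (butlast w)))"
      by (simp flip: sum_distrib_left)
  qed simp
  finally show ?thesis .
qed

lemma stationary_expectation_take:
  fixes g :: "bool list \<Rightarrow> real"
  assumes p: "stationary_distribution (words m b) (rjmc b x) p"
    and q: "stationary_distribution (words m b) (rjmc b x) q"
    and "n \<le> m"
  shows "(\<Sum>w\<in>words m b. p w * g (take n w)) = (\<Sum>w\<in>words m b. q w * g (take n w))"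
  using \<open>n \<le> m\<close>
proof (induction n arbitrary: g)
  case 0
  then show ?case
    using p q by (simp add: stationary_distribution_def flip: sum_distrib_right)
next
  case (Suc n)
  have m: "1 \<le> m" using Suc.prems by simp
  \<comment> \<open>Mean of \<open>g\<close> after one move, as a function of the first
    \<open>n\<close> letters; this is why the induction needs \<open>g\<close> arbitrary.\<close>
  define G where "G u = (\<Sum>i\<le>b. x i * g (move i u))" for u
  have *: "(\<Sum>w\<in>words m b. r w * g (take (Suc n) w)) = (\<Sum>w\<in>words m b. r w * G (take n w))"
    if "stationary_distribution (words m b) (rjmc b x) r" for r
  proof -
    have "take (Suc n) (move i (butlast w)) = move i (take n w)" if "w \<in> words m b" for i w
      using that Suc.prems by (simp add: words_def take_move take_butlast)
    then show ?thesis
      unfolding G_def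
      by (subst stationary_expectation[OF that m]) (auto intro!: sum.cong)
  qed
  show ?case
    using Suc.IH[of G] Suc.prems by (simp add: *[OF p] *[OF q])
qed

lemma stationary_unique:
  assumes "stationary_distribution (words m b) (rjmc b x) p"
    and "stationary_distribution (words m b) (rjmc b x) q"
    and "v \<in> words m b"
  shows "p v = q v"
proof -
  \<comment> \<open>At \<open>n = m\<close> nothing is truncated, so the indicator of
    \<open>v\<close> recovers the single probability.\<close>
  let ?g = "\<lambda>u. if u = v then 1 else 0 :: real"
  have "(\<Sum>w\<in>words m b. r w * ?g (take m w)) = r v" for r
  proof -
    have "(\<Sum>w\<in>words m b. r w * ?g (take m w)) = (\<Sum>w\<in>words m b. if w = v then r w else 0)"
      by (rule sum.cong) (auto simp: words_def)
    then show ?thesis using assms(3) by simp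
  qed
  then show ?thesis
    using stationary_expectation_take[OF assms(1,2), of m ?g] by simp
qed


section \<open>The stationary weight\<close>

text \<open>Defined without a bound on the number of ones, so that it can be summed over all words
  of a given length.\<close>

definition weight :: "(nat \<Rightarrow> real) \<Rightarrow> bool list \<Rightarrow> real" where
  "weight x w = (\<Prod>i<num_ones w. zbar x i) *
     (\<Prod>i\<le>num_ones w. z x i ^ (one_pos w (i + 1) - one_pos w i - 1))"

abbreviation letter_weight :: "(nat \<Rightarrow> real) \<Rightarrow> nat \<Rightarrow> bool \<Rightarrow> real" where
  "letter_weight x k c \<equiv> (if c then zbar x k else z x k)"

lemma weight_Nil [simp]: "weight x [] = 1"
  by (simp add: weight_def one_pos_def)

text \<open>A final one adds the factor \<open>zbar x k\<close>, keeps the exponent of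
  \<open>z x k\<close> and opens a new gap of exponent 0. A final zero raises that exponent by
  one.\<close>

lemma weight_snoc: "weight x (w @ [c]) = weight x w * letter_weight x (num_ones w) c"
proof -
  define k where "k = num_ones w"
  define e where "e w i = one_pos w (i + 1) - one_pos w i - 1" for w i
  have e_less: "e (w @ [c]) i = e w i" if "i < k" for i
    using that by (simp add: e_def one_pos_snoc k_def)
  have e_k: "e w k = length w - one_pos w k"
    by (simp add: e_def k_def one_pos_last)
  have weight: "weight x w' = (\<Prod>i<num_ones w'. zbar x i) *
      (\<Prod>i\<le>num_ones w'. z x i ^ e w' i)" for w'
    by (simp add: weight_def e_def)
  have split: "(\<Prod>i\<le>k. z x i ^ e w' i) = (\<Prod>i<k. z x i ^ e w' i) * z x k ^ e w' k" for w'
    by (simp flip: lessThan_Suc_atMost)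
  have low: "(\<Prod>i<k. z x i ^ e (w @ [c]) i) = (\<Prod>i<k. z x i ^ e w i)"
    by (rule prod.cong) (simp_all add: e_less)
  show ?thesis
  proof (cases c)
    case True
    have 1: "e (w @ [c]) k = e w k"
      using True by (simp add: e_k) (simp add: e_def k_def one_pos_snoc one_pos_snoc_True)
    have 2: "e (w @ [c]) (Suc k) = 0"
      using True one_pos_last[of "w @ [True]"]
      by (simp add: e_def k_def one_pos_snoc_True)
    show ?thesis
      using True low 1 2 by (simp add: weight split flip: k_def)
  next
    case False
    \<comment> \<open>\<open>one_pos_le_length\<close> rules out truncation in the natural-number
      subtraction.\<close>
    have "e (w @ [c]) k = Suc (e w k)"
      using False one_pos_last[of "w @ [False]"] one_pos_le_length[of k w]
      by (simp add: e_k) (simp add: e_def k_def one_pos_snoc Suc_diff_le)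
    then show ?thesis
      using False low by (simp add: weight split flip: k_def)
  qed
qed

lemma sum_lists_snoc:
  "(\<Sum>w | length w = Suc n. f w) =
   (\<Sum>r | length r = n. f (r @ [False]) + f (r @ [True]))" for f :: "bool list \<Rightarrow> real"
proof -
  have "(\<Sum>w | length w = Suc n. f w) =
        (\<Sum>(r, c) \<in> {r. length r = n} \<times> (UNIV :: bool set). f (r @ [c]))"
    by (rule sum.reindex_bij_witness[of _ "\<lambda>(r, c). r @ [c]" "\<lambda>w. (butlast w, last w)"])
       (auto simp: length_Suc_conv_rev)
  also have "\<dots> = (\<Sum>r | length r = n. \<Sum>c\<in>UNIV. f (r @ [c]))"
    by (simp add: sum.cartesian_product)
  finally show ?thesis by (simp add: UNIV_bool)
qed

lemma weight_sum: "(\<Sum>w | length w = n. weight x w) = 1"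
proof (induction n)
  case (Suc n)
  have "weight x (r @ [False]) + weight x (r @ [True]) = weight x r" for r
    by (simp add: weight_snoc zbar_def algebra_simps)
  then show ?case using Suc by (simp add: sum_lists_snoc)
qed simp

section \<open>Invariance of the weight under the chain\<close>

context
  fixes b :: nat and x :: "nat \<Rightarrow> real"
  assumes nonneg: "\<forall>i\<le>b. 0 \<le> x i" and total: "(\<Sum>i\<le>b. x i) = 1"
begin

lemma zbar_eq_sum:
  assumes "k \<le> b"
  shows "zbar x k = (\<Sum>i = Suc k..b. x i)"
proof -
  have "{..b} = {..k} \<union> {Suc k..b}" using assms by auto
  then have "(\<Sum>i\<le>b. x i) = (\<Sum>i\<le>k. x i) + (\<Sum>i = Suc k..b. x i)"
    by (simp add: sum.union_disjoint)
  then show ?thesis using total by (simp add: zbar_def z_def)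
qed

text \<open>The first product then contains the factor \<open>zbar x b\<close>, which
  vanishes.\<close>

lemma weight_eq_0:
  assumes "num_ones w > b"
  shows "weight x w = 0"
proof -
  have "zbar x b = 0" using zbar_eq_sum[of b] by simp
  then have "(\<Prod>i<num_ones w. zbar x i) = 0" using assms by auto
  then show ?thesis by (simp add: weight_def)
qed

lemma weight_nonneg:
  assumes "num_ones w \<le> b"
  shows "weight x w \<ge> 0"
proof -
  have "z x i \<ge> 0" "zbar x i \<ge> 0" if "i \<le> b" for i
    using that nonneg by (auto simp: zbar_eq_sum z_def intro!: sum_nonneg)
  then show ?thesis
    using assms unfolding weight_def by (intro mult_nonneg_nonneg prod_nonneg) auto
qed

text \<open>The sum over \<open>i\<close> on both sides splits at \<open>i \<le> num_ones r\<close>, where the identity holds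
  termwise, and \<open>i > num_ones r\<close>, where \<open>move i r\<close> does not depend on \<open>i\<close>.\<close>

lemma letter_weight_move:
  assumes "num_ones r \<le> b"
  shows "(\<Sum>c\<in>UNIV. letter_weight x (num_ones r) c *
           (\<Sum>i\<le>b. if s @ [a] = move i (r @ [c]) then x i else 0)) =
         letter_weight x (num_ones s) a * (\<Sum>i\<le>b. if s = move i r then x i else 0)"
proof -
  define k where "k = num_ones r"
  define T where "T = True # r"
  have T: "move i r = T" if "i > k" for i
    using that by (auto simp: move_def T_def k_def)
  have num_T: "num_ones T = Suc k" by (simp add: T_def k_def)
  define lhs where "lhs i = (\<Sum>c\<in>UNIV. letter_weight x k c *
      (if s @ [a] = move i (r @ [c]) then x i else 0))" for i
  define rhs where "rhs i = letter_weight x (num_ones s) a * (if s = move i r then x i else 0)" for i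
  have split: "{..b} = {..k} \<union> {Suc k..b}" using assms by (auto simp: k_def)
  \<comment> \<open>Here \<open>i\<close> never erases the appended letter, so \<open>c = a\<close>
    is forced, and \<open>move i r\<close> again has \<open>k\<close> ones, so the letter weights
    agree.\<close>
  have low: "lhs i = rhs i" if "i \<le> k" for i
    using that by (auto simp: lhs_def rhs_def UNIV_bool move_snoc k_def num_ones_move)
  have high: "sum lhs {Suc k..b} = sum rhs {Suc k..b}"
  proof (cases "s = T")
    case False
    then show ?thesis by (auto simp: lhs_def rhs_def UNIV_bool move_snoc T intro!: sum.cong)
  next
    case True
    have R: "sum rhs {Suc k..b} = letter_weight x (Suc k) a * zbar x k"
      using assms by (simp add: rhs_def True num_T T zbar_eq_sum k_def flip: sum_distrib_left)
    show ?thesis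
    \<comment> \<open>For \<open>k = b\<close> both sums are empty; otherwise
      \<open>zbar x (Suc k)\<close> may be written as a sum.\<close>
    proof (cases "k = b")
      case True
      then show ?thesis by simp
    next
      case kb: False
      then have "k < b" using assms by (simp add: k_def)
      then have ins: "{Suc k..b} = insert (Suc k) {Suc (Suc k)..b}" by auto
      have tail: "sum lhs {Suc (Suc k)..b} = letter_weight x k a * zbar x (Suc k)"
      proof -
        have "sum lhs {Suc (Suc k)..b} = (\<Sum>i = Suc (Suc k)..b. letter_weight x k a * x i)"
          by (rule sum.cong) (auto simp: lhs_def UNIV_bool move_snoc T True simp flip: k_def)
        then show ?thesis
          using \<open>k < b\<close> by (simp add: zbar_eq_sum sum_distrib_left)
      qed
      \<comment> \<open>At \<open>i = Suc k\<close> both values of \<open>c\<close> lead to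
        \<open>T @ [False]\<close>, hence the total letter weight.\<close>
      have head: "lhs (Suc k) = (if a then 0 else (z x k + zbar x k) * x (Suc k))"
        by (auto simp: lhs_def UNIV_bool move_snoc T True algebra_simps simp flip: k_def)
      have zS: "z x (Suc k) = z x k + x (Suc k)" by (simp add: z_def)
      have "sum lhs {Suc k..b} = lhs (Suc k) + sum lhs {Suc (Suc k)..b}"
        by (simp add: ins)
      then show ?thesis
        \<comment> \<open>For \<open>a\<close> false this is z_k zbar_(k+1) + x_(k+1) = z_(k+1)
          zbar_k; for \<open>a\<close> true both sides are zbar_k zbar_(k+1).\<close>
        unfolding R tail head by (auto simp: zbar_def zS algebra_simps)
    qed
  qed
  have "sum lhs {..b} = sum rhs {..b}"
    unfolding split using low high by (simp add: sum.union_disjoint)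
  then show ?thesis
    by (simp add: lhs_def rhs_def UNIV_bool sum.distrib sum_distrib_left flip: k_def)
qed

text \<open>Peeling the last letter off both \<open>t\<close> and \<open>u\<close> turns the claim
  into the one for shorter words, times the letter weight of \<open>a\<close>.\<close>

lemma weight_move:
  assumes "length t = Suc n"
  shows "(\<Sum>u | length u = n. weight x u * (\<Sum>i\<le>b. if t = move i u then x i else 0)) = weight x t"
  using assms
proof (induction n arbitrary: t)
  case 0
  then obtain a where t: "t = [a]" by (auto simp: length_Suc_conv)
  have "{..b} = insert 0 {Suc 0..b}" by auto
  then have "(\<Sum>i\<le>b. if a = (i \<noteq> 0) then x i else 0) = (if a then \<Sum>i = Suc 0..b. x i else x 0)"
    by (auto intro!: sum.neutral)
  then show ?case
    using weight_snoc[of x "[]" a] by (simp add: t zbar_eq_sum) (simp add: z_def)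
next
  case (Suc n)
  then obtain s a where t: "t = s @ [a]" and s: "length s = Suc n"
    by (auto simp: length_Suc_conv_rev[of t])
  let ?K = "\<lambda>t u. \<Sum>i\<le>b. if t = move i u then x i else 0"
  have "(\<Sum>u | length u = Suc n. weight x u * ?K t u) =
        (\<Sum>r | length r = n. weight x r *
          (\<Sum>c\<in>UNIV. letter_weight x (num_ones r) c * ?K (s @ [a]) (r @ [c])))"
    unfolding sum_lists_snoc t by (simp add: weight_snoc UNIV_bool algebra_simps)
  also have "\<dots> = (\<Sum>r | length r = n. weight x r * (letter_weight x (num_ones s) a * ?K s r))"
  proof (rule sum.cong)
    fix r
    show "weight x r * (\<Sum>c\<in>UNIV. letter_weight x (num_ones r) c * ?K (s @ [a]) (r @ [c])) =
          weight x r * (letter_weight x (num_ones s) a * ?K s r)"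
    \<comment> \<open>Words with more than \<open>b\<close> ones lie outside
      \<open>letter_weight_move\<close> but have weight 0.\<close>
    proof (cases "num_ones r \<le> b")
      case True
      then show ?thesis by (simp only: letter_weight_move)
    next
      case False
      then show ?thesis by (simp add: weight_eq_0)
    qed
  qed simp
  also have "\<dots> = letter_weight x (num_ones s) a * (\<Sum>r | length r = n. weight x r * ?K s r)"
    by (simp add: sum_distrib_left mult.left_commute)
  also have "\<dots> = weight x t"
    using Suc.IH[OF s] by (simp add: t weight_snoc)
  finally show ?case .
qed

text \<open>Frees the sum from the bound on ones, so that the last letter can be split off.\<close>

lemma sum_words_weight:
  "(\<Sum>w\<in>words m b. weight x w * f w) = (\<Sum>w | length w = m. weight x w * f w)"
  by (rule sum.mono_neutral_left[OF finite_lists_length])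
     (auto simp: words_def intro: weight_eq_0 leI)

lemma weight_stationary:
  assumes "1 \<le> m"
  shows "stationary_distribution (words m b) (rjmc b x) (weight x)"
  unfolding stationary_distribution_def
proof (intro conjI ballI)
  show "weight x w \<ge> 0" if "w \<in> words m b" for w
    using that by (simp add: words_def weight_nonneg)
  show "(\<Sum>w\<in>words m b. weight x w) = 1"
    using sum_words_weight[where f = "\<lambda>_. 1"] by (simp add: weight_sum)
  fix t assume t: "t \<in> words m b"
  obtain n where n: "m = Suc n" using assms by (cases m) auto
  let ?K = "\<lambda>u. \<Sum>i\<le>b. if t = move i u then x i else 0"
  have "(\<Sum>w\<in>words m b. weight x w * rjmc b x w t) = (\<Sum>w\<in>words m b. weight x w * ?K (butlast w))"
    by (rule sum.cong) (auto simp: words_def rjmc_eq_move)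
  \<comment> \<open>The move ignores the last letter, whose two weights add up to 1.\<close>
  also have "\<dots> = (\<Sum>r | length r = n. weight x r * ?K r)"
    unfolding sum_words_weight n sum_lists_snoc
    by (simp add: weight_snoc zbar_def algebra_simps)
  also have "\<dots> = weight x t"
    using t by (intro weight_move) (simp add: words_def n)
  finally show "(\<Sum>w\<in>words m b. weight x w * rjmc b x w t) = weight x t" .
qed

end

text \<open>For the converse direction of the theorem: the formula fixes \<open>\<pi>\<close> on the
  state space only.\<close>

lemma stationary_distribution_cong:
  assumes "\<And>s. s \<in> S \<Longrightarrow> p s = q s"
  shows "stationary_distribution S M p \<longleftrightarrow> stationary_distribution S M q"
  using assms by (simp add: stationary_distribution_def)

theorem theorem2p2:
  fixes m b :: nat and x :: "nat \<Rightarrow> real" and \<pi> :: "bool list \<Rightarrow> real"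
  assumes "1 \<le> b" and "b \<le> m"
    and "\<forall>i\<le>b. 0 \<le> x i"
    and "(\<Sum>i\<le>b. x i) = 1"
  shows "stationary_distribution (words m b) (rjmc b x) \<pi> \<longleftrightarrow>
    (\<forall>w\<in>words m b.
       \<pi> w = (\<Prod>i<num_ones w. zbar x i) *
              (\<Prod>i\<le>num_ones w. z x i ^ (one_pos w (i + 1) - one_pos w i - 1)))"
proof -
  have st: "stationary_distribution (words m b) (rjmc b x) (weight x)"
    using assms by (intro weight_stationary) auto
  have "stationary_distribution (words m b) (rjmc b x) \<pi> \<longleftrightarrow>
        (\<forall>w\<in>words m b. \<pi> w = weight x w)"
    using st stationary_unique[OF _ st]
      stationary_distribution_cong[of "words m b" \<pi> "weight x"] by blast
  then show ?thesis by (simp add: weight_def)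
qed

end
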